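(* Let $G=(V,E,\vartheta,w)$ be a connected finite or locally finite weighted graph with $D_{\vartheta}<\infty$. Let $m: V\times(0,\infty)\to\mathbb{R}^+$ be a variable exponent, $\delta: V\times(0,\infty)\to\mathbb{R}$ a weight function, $b(x,u)$ and $\gamma(t)$ given real-valued functions, and suppose $u=u(x,t)>0$ is a solution on $V\times(0,\infty)$ of $$\Delta(u^{m(x,t)})-b(x,u)u=\delta(x,t)u_t+\gamma(t)u^{m(x,t)}.$$ Assume that $b(x,u)\le\varphi(x,t)u^{m(x,t)-1}$ for some function $\varphi: V\times(0,\infty)\to\mathbb{R}$, and that $\gamma(t)\le c_1+\frac{c_2}{t}$ for constants $c_1,c_2\in\mathbb{R}$. Then for any $x\in V$, $t>0$, and any function $\alpha(t)\ge1$, $$\frac{2\Gamma(u^{\frac{m(x,t)}{2}})}{u^{m(x,t)}}-\alpha(t)\frac{\delta u_t}{u^{m(x,t)}}\le 2\alpha(t)D_{\vartheta}+\alpha(t)\varphi(x,t)+\alpha(t)\left(c_1+\frac{c_2}{t}\right).$$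
   Context: $G$ has vertex set $V$, edge set $E$, vertex measure $\vartheta:V\to(0,\infty)$ and symmetric edge weights $w_{xy}=w_{yx}>0$ if $x\sim y$ (adjacent), $w_{xy}=0$ otherwise. Locally finite: every vertex has finitely many neighbors. $\deg(x)=\sum_{y\sim x}w_{xy}$ and $D_{\vartheta}:=\max_{x\in V}\frac{\deg(x)}{\vartheta(x)}$. For $f:V\to\mathbb{R}$, $$\Delta f(x)=\frac{1}{\vartheta(x)}\sum_{y\sim x}w_{xy}(f(y)-f(x)),\qquad \Gamma(f)(x)=\frac{1}{2\vartheta(x)}\sum_{y\sim x}w_{xy}(f(y)-f(x))^2.$$ Notation: for fixed $t$, $u^{m(x,t)}$ denotes the function $x\mapsto u(x,t)^{m(x,t)}$ on $V$, and $u^{m(x,t)/2}$ denotes $x\mapsto u(x,t)^{m(x,t)/2}$ (the exponent is evaluated at the same vertex as $u$); operators act in the vertex variable. $u_t$ is the time derivative. *)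

theory Defs
  imports "HOL-Analysis.Analysis"
begin

text \<open>
  An undirected graph is given by its vertex set and its symmetric adjacency relation.
  Functions on the vertices are total on \<open>'a\<close>; their values outside \<open>verts G\<close> are irrelevant.
\<close>

record 'a wgraph =
  verts :: "'a set"
  edges :: "('a \<times> 'a) set"
  vmeas :: "'a \<Rightarrow> real"
  wt :: "'a \<Rightarrow> 'a \<Rightarrow> real"

definition nbrs :: "'a wgraph \<Rightarrow> 'a \<Rightarrow> 'a set" where
  "nbrs G x = {y. (x, y) \<in> edges G}"

definition weighted_graph :: "'a wgraph \<Rightarrow> bool" where
  "weighted_graph G \<longleftrightarrow>
     edges G \<subseteq> verts G \<times> verts G \<and> sym (edges G) \<and>
     (\<forall>x\<in>verts G. vmeas G x > 0) \<and>
     (\<forall>x\<in>verts G. \<forall>y\<in>verts G. wt G x y = wt G y x) \<and>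
     (\<forall>x\<in>verts G. \<forall>y\<in>verts G. if (x, y) \<in> edges G then wt G x y > 0 else wt G x y = 0)"

text \<open>Every finite graph is locally finite in this sense.\<close>

definition locally_finite_graph :: "'a wgraph \<Rightarrow> bool" where
  "locally_finite_graph G \<longleftrightarrow> (\<forall>x\<in>verts G. finite (nbrs G x))"

definition connected_graph :: "'a wgraph \<Rightarrow> bool" where
  "connected_graph G \<longleftrightarrow> (\<forall>x\<in>verts G. \<forall>y\<in>verts G. (x, y) \<in> (edges G)\<^sup>*)"

definition wdeg :: "'a wgraph \<Rightarrow> 'a \<Rightarrow> real" where
  "wdeg G x = (\<Sum>y\<in>nbrs G x. wt G x y)"

text \<open>
  The constant \<open>D\<close> is the maximum of \<open>deg(x)/\<theta>(x)\<close>, read as a supremum on infinite graphs.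
  The real-valued supremum is meaningful only when the quotients are bounded above,
  so \<open>D < \<infinity>\<close> is the separate predicate \<open>D_finite\<close>.
\<close>

definition D_finite :: "'a wgraph \<Rightarrow> bool" where
  "D_finite G \<longleftrightarrow> bdd_above ((\<lambda>x. wdeg G x / vmeas G x) ` verts G)"

definition D_const :: "'a wgraph \<Rightarrow> real" where
  "D_const G = (SUP x\<in>verts G. wdeg G x / vmeas G x)"

definition laplacian :: "'a wgraph \<Rightarrow> ('a \<Rightarrow> real) \<Rightarrow> 'a \<Rightarrow> real" where
  "laplacian G f x = 1 / vmeas G x * (\<Sum>y\<in>nbrs G x. wt G x y * (f y - f x))"

definition Gamma_op :: "'a wgraph \<Rightarrow> ('a \<Rightarrow> real) \<Rightarrow> 'a \<Rightarrow> real" where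
  "Gamma_op G f x = 1 / (2 * vmeas G x) * (\<Sum>y\<in>nbrs G x. wt G x y * (f y - f x)\<^sup>2)"

text \<open>
  Positive solutions on \<open>V \<times> (0,\<infinity>)\<close> of
  \<open>\<Delta>(u\<^sup>m) - b(x,u) u = \<delta> u\<^sub>t + \<gamma>(t) u\<^sup>m\<close> with variable exponent \<open>m = m(x,t)\<close>.
  Of time regularity only the existence of \<open>u\<^sub>t\<close> is required.
\<close>

definition positive_solution ::
  "'a wgraph \<Rightarrow> ('a \<Rightarrow> real \<Rightarrow> real) \<Rightarrow> ('a \<Rightarrow> real \<Rightarrow> real) \<Rightarrow> ('a \<Rightarrow> real \<Rightarrow> real)
    \<Rightarrow> (real \<Rightarrow> real) \<Rightarrow> ('a \<Rightarrow> real \<Rightarrow> real) \<Rightarrow> bool" where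
  "positive_solution G m \<delta> b \<gamma> u \<longleftrightarrow>
     (\<forall>x\<in>verts G. \<forall>t>0.
        u x t > 0 \<and>
        (\<lambda>s. u x s) differentiable (at t) \<and>
        laplacian G (\<lambda>y. u y t powr m y t) x - b x (u x t) * u x t
          = \<delta> x t * deriv (\<lambda>s. u x s) t + \<gamma> t * u x t powr m x t)"

end

theory Submission
  imports Defs
begin

text \<open>
  Fix a time \<open>t\<close> and put \<open>f = u\<^sup>m\<^sup>/\<^sup>2\<close>, so that \<open>f\<^sup>2 = u\<^sup>m\<close>. On a graph the chain rule fails for
  general powers, but for the square there is the exact identity
  \<open>\<Delta>(f\<^sup>2) = 2 \<Gamma>(f) + 2 f \<Delta>f\<close> (\<open>laplacian_square\<close>). It holds for every function \<open>f\<close>, so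
  the dependence of the exponent on the vertex does no harm. The Laplacian has no sign, but
  for \<open>f \<ge> 0\<close> it is bounded below by the contribution of the centre, \<open>- f(x) deg(x)/\<theta>(x)\<close>
  (\<open>laplacian_lower_bound\<close>). Hence \<open>2 \<Gamma>(f) \<le> \<Delta>(f\<^sup>2) + 2 D f\<^sup>2\<close>
  (\<open>Gamma_op_le_laplacian_square\<close>), an inequality
  that does not involve the equation.

  The equation then replaces \<open>\<Delta>(f\<^sup>2) = \<Delta>(u\<^sup>m)\<close> by \<open>b u + \<delta> u\<^sub>t + \<gamma> u\<^sup>m\<close>, and after
  division by \<open>u\<^sup>m\<close> the bounds on \<open>b\<close> and \<open>\<gamma>\<close> give the claim for \<open>\<alpha> = 1\<close>. The case
  \<open>\<alpha> \<ge> 1\<close> follows on multiplying by \<open>\<alpha>\<close>, because \<open>\<Gamma>(f) \<ge> 0\<close> makes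
  \<open>2 \<Gamma>(f)/u\<^sup>m\<close> at most \<open>\<alpha>\<close> times itself.
\<close>

lemma weighted_graph_wt_pos:
  assumes "weighted_graph G" and "y \<in> nbrs G x"
  shows "wt G x y > 0"
proof -
  have "(x, y) \<in> edges G"
    using assms(2) by (simp add: nbrs_def)
  moreover from this have "x \<in> verts G" "y \<in> verts G"
    using assms(1) by (auto simp: weighted_graph_def)
  ultimately show ?thesis
    using assms(1) unfolding weighted_graph_def by metis
qed

lemma nbrs_subset_verts: "weighted_graph G \<Longrightarrow> nbrs G x \<subseteq> verts G"
  by (auto simp: weighted_graph_def nbrs_def)

lemma Gamma_op_nonneg:
  assumes "weighted_graph G" and "x \<in> verts G"
  shows "Gamma_op G f x \<ge> 0"
proof -
  have "vmeas G x > 0"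
    using assms by (simp add: weighted_graph_def)
  moreover have "(\<Sum>y\<in>nbrs G x. wt G x y * (f y - f x)\<^sup>2) \<ge> 0"
    using weighted_graph_wt_pos[OF assms(1)] by (intro sum_nonneg) (simp add: less_imp_le)
  ultimately show ?thesis
    by (simp add: Gamma_op_def)
qed

text \<open>
  Edge by edge this is \<open>b\<^sup>2 - a\<^sup>2 = (b - a)\<^sup>2 + 2 a (b - a)\<close>: the quadratic increments, which sum to
  \<open>2 \<Gamma>(f)\<close>, are what the chain rule for the square misses.
\<close>

lemma laplacian_square:
  "laplacian G (\<lambda>y. (f y)\<^sup>2) x = 2 * Gamma_op G f x + 2 * f x * laplacian G f x"
proof -
  have "(\<Sum>y\<in>nbrs G x. wt G x y * ((f y)\<^sup>2 - (f x)\<^sup>2))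
      = (\<Sum>y\<in>nbrs G x. wt G x y * (f y - f x)\<^sup>2 + 2 * f x * (wt G x y * (f y - f x)))"
    by (intro sum.cong) (auto simp: power2_eq_square algebra_simps)
  also have "\<dots> = (\<Sum>y\<in>nbrs G x. wt G x y * (f y - f x)\<^sup>2)
      + 2 * f x * (\<Sum>y\<in>nbrs G x. wt G x y * (f y - f x))"
    by (simp add: sum.distrib sum_distrib_left)
  finally show ?thesis
    by (simp add: laplacian_def Gamma_op_def algebra_simps add_divide_distrib)
qed

text \<open>
  The values at the neighbours enter the Laplacian with positive weight, so for a nonnegative
  function replacing them by \<open>0\<close> can only decrease it.
\<close>

lemma laplacian_lower_bound:
  assumes "weighted_graph G" and "x \<in> verts G"
    and "\<And>y. y \<in> nbrs G x \<Longrightarrow> f y \<ge> 0"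
  shows "laplacian G f x \<ge> - (wdeg G x / vmeas G x * f x)"
proof -
  have "vmeas G x > 0"
    using assms by (simp add: weighted_graph_def)
  have "(\<Sum>y\<in>nbrs G x. - (wt G x y * f x)) \<le> (\<Sum>y\<in>nbrs G x. wt G x y * (f y - f x))"
    using weighted_graph_wt_pos[OF assms(1)] assms(3)
    by (intro sum_mono) (simp add: algebra_simps less_imp_le)
  then have "- (wdeg G x * f x) \<le> (\<Sum>y\<in>nbrs G x. wt G x y * (f y - f x))"
    by (simp add: wdeg_def sum_negf sum_distrib_right)
  from divide_right_mono[OF this less_imp_le[OF \<open>vmeas G x > 0\<close>]] show ?thesis
    by (simp add: laplacian_def)
qed

lemma wdeg_le_D_const:
  assumes "D_finite G" and "x \<in> verts G"
  shows "wdeg G x / vmeas G x \<le> D_const G"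
  using assms unfolding D_const_def D_finite_def by (intro cSUP_upper)

text \<open>
  The term \<open>2 f \<Delta>f\<close> of the square identity is bounded below, at the cost of the zeroth-order
  term \<open>2 D f\<^sup>2\<close>.
\<close>

lemma Gamma_op_le_laplacian_square:
  assumes "weighted_graph G" and "D_finite G" and "x \<in> verts G"
    and nonneg: "\<And>y. y \<in> verts G \<Longrightarrow> f y \<ge> 0"
  shows "2 * Gamma_op G f x \<le> laplacian G (\<lambda>y. (f y)\<^sup>2) x + 2 * D_const G * (f x)\<^sup>2"
proof -
  have "wdeg G x / vmeas G x * f x \<le> D_const G * f x"
    using assms by (intro mult_right_mono wdeg_le_D_const)
  moreover have "- (wdeg G x / vmeas G x * f x) \<le> laplacian G f x"
    using assms nbrs_subset_verts[OF assms(1)] by (intro laplacian_lower_bound) auto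
  ultimately have "- (D_const G * f x) \<le> laplacian G f x"
    by linarith
  then have "f x * - (D_const G * f x) \<le> f x * laplacian G f x"
    using nonneg[OF assms(3)] by (rule mult_left_mono)
  then have "- (2 * D_const G * (f x)\<^sup>2) \<le> 2 * f x * laplacian G f x"
    by (simp add: power2_eq_square algebra_simps)
  then show ?thesis
    using laplacian_square[of G f x] by linarith
qed

theorem theorem3p6:
  fixes G :: "'a wgraph"
    and m \<delta> b \<phi> u :: "'a \<Rightarrow> real \<Rightarrow> real"
    and \<gamma> \<alpha> :: "real \<Rightarrow> real"
    and c1 c2 :: real
  assumes "weighted_graph G"
    and "connected_graph G"
    and "locally_finite_graph G"
    and "D_finite G"
    and "\<And>x t. x \<in> verts G \<Longrightarrow> t > 0 \<Longrightarrow> m x t > 0"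
    and "positive_solution G m \<delta> b \<gamma> u"
    and "\<And>x t. x \<in> verts G \<Longrightarrow> t > 0 \<Longrightarrow> b x (u x t) \<le> \<phi> x t * u x t powr (m x t - 1)"
    and "\<And>t. t > 0 \<Longrightarrow> \<gamma> t \<le> c1 + c2 / t"
    and "\<And>t. t > 0 \<Longrightarrow> \<alpha> t \<ge> 1"
  shows "\<forall>x\<in>verts G. \<forall>t>0.
      2 * Gamma_op G (\<lambda>y. u y t powr (m y t / 2)) x / (u x t powr m x t)
        - \<alpha> t * (\<delta> x t * deriv (\<lambda>s. u x s) t / (u x t powr m x t))
      \<le> 2 * \<alpha> t * D_const G + \<alpha> t * \<phi> x t + \<alpha> t * (c1 + c2 / t)"
proof (intro ballI allI impI)
  fix x t
  assume x: "x \<in> verts G" and t: "t > (0::real)"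
  define f where "f = (\<lambda>y. u y t powr (m y t / 2))"
  define F where "F = u x t powr m x t"
  define v where "v = \<delta> x t * deriv (\<lambda>s. u x s) t"
  have u_pos: "u x t > 0"
    and eq: "laplacian G (\<lambda>y. u y t powr m y t) x - b x (u x t) * u x t = v + \<gamma> t * F"
    using assms(6) x t by (auto simp: positive_solution_def v_def F_def)
  have F_pos: "F > 0"
    using u_pos by (simp add: F_def)
  have sq: "(f y)\<^sup>2 = u y t powr m y t" for y
    by (simp add: f_def power2_eq_square flip: powr_add)

  have "b x (u x t) * u x t \<le> \<phi> x t * u x t powr (m x t - 1) * u x t"
    using assms(7)[OF x t] u_pos by (intro mult_right_mono) auto
  also have "\<dots> = \<phi> x t * F"
    using u_pos by (simp add: F_def powr_diff)
  finally have b_le: "b x (u x t) * u x t \<le> \<phi> x t * F" .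
  have \<gamma>_le: "\<gamma> t * F \<le> (c1 + c2 / t) * F"
    using assms(8)[OF t] F_pos by (intro mult_right_mono) auto
  have "2 * Gamma_op G f x \<le> laplacian G (\<lambda>y. u y t powr m y t) x + 2 * D_const G * F"
    using Gamma_op_le_laplacian_square[OF assms(1,4) x, of f]
    by (simp only: sq F_def) (simp add: f_def)
  then have "2 * Gamma_op G f x - v \<le> (2 * D_const G + \<phi> x t + (c1 + c2 / t)) * F"
    using eq b_le \<gamma>_le unfolding distrib_right by linarith
  then have "(2 * Gamma_op G f x - v) / F \<le> 2 * D_const G + \<phi> x t + (c1 + c2 / t)"
    by (simp only: pos_divide_le_eq[OF F_pos])
  then have est: "\<alpha> t * (2 * Gamma_op G f x / F - v / F)
      \<le> \<alpha> t * (2 * D_const G + \<phi> x t + (c1 + c2 / t))"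
    using assms(9)[OF t] by (intro mult_left_mono) (simp_all add: diff_divide_distrib)

  have "2 * Gamma_op G f x / F \<ge> 0"
    using Gamma_op_nonneg[OF assms(1) x] F_pos by simp
  then have "1 * (2 * Gamma_op G f x / F) \<le> \<alpha> t * (2 * Gamma_op G f x / F)"
    using assms(9)[OF t] by (intro mult_right_mono)
  with est have "2 * Gamma_op G f x / F - \<alpha> t * (v / F)
      \<le> \<alpha> t * (2 * D_const G + \<phi> x t + (c1 + c2 / t))"
    unfolding right_diff_distrib by linarith
  also have "\<dots> = 2 * \<alpha> t * D_const G + \<alpha> t * \<phi> x t + \<alpha> t * (c1 + c2 / t)"
    by (simp add: distrib_left)
  finally show "2 * Gamma_op G (\<lambda>y. u y t powr (m y t / 2)) x / (u x t powr m x t)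
        - \<alpha> t * (\<delta> x t * deriv (\<lambda>s. u x s) t / (u x t powr m x t))
      \<le> 2 * \<alpha> t * D_const G + \<alpha> t * \<phi> x t + \<alpha> t * (c1 + c2 / t)"
    by (simp only: f_def F_def v_def)
qed

end
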